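(* Let $q$ be a prime power, $n$ a positive integer, and let $f(x)$ be an irreducible polynomial of degree $d$ over $\mathbb{F}_q$ dividing $x^n-1$. Let $\omega$ be a root of $f$ in an extension field, so that $\{1,\omega,\dots,\omega^{d-1}\}$ is a basis of $\mathbb{F}_q[\omega]$ over $\mathbb{F}_q$, and for $1\le i\le n$ write \[\omega^i=a_{i1}+a_{i2}\omega+\dots+a_{id}\omega^{d-1},\qquad a_{ij}\in\mathbb{F}_q.\] Then there exists a $(d-1)$-dimensional $\mathbb{F}_q$-subspace $V$ of $\mathbb{F}_q[\omega]$ with $\bigcup_{i=0}^{n-1}\omega^iV=\mathbb{F}_q[\omega]$ if and only if for every $(x_1,\dots,x_d)\in(\mathbb{F}_q^* )^d$ there exists an integer $i$ with $d\le i\le n$ such that \[x_1a_{i1}+x_2a_{i2}+\dots+x_da_{id}=0.\]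
   Context: Here $\omega^iV=\{\omega^iv: v\in V\}$; i.e., the covering is with respect to the $\mathbb{F}_q$-linear map of multiplication by $\omega$ on $\mathbb{F}_q[\omega]$ (which corresponds to multiplication by $x$ on $\mathbb{F}_q[x]/(f(x))$). *)

theory Defs
  imports "HOL-Computational_Algebra.Polynomial" "Jordan_Normal_Form.Char_Poly"
begin

text \<open>
  Throughout, an extension of the field \<open>'a\<close> is a field \<open>'b\<close> together with a field homomorphism
  \<open>\<iota> :: 'a \<Rightarrow> 'b\<close> (locale \<open>field_hom\<close>), which makes \<open>'b\<close> an \<open>'a\<close>-vector space.
\<close>

definition ext_scale :: "('a::field \<Rightarrow> 'b::field) \<Rightarrow> 'a \<Rightarrow> 'b \<Rightarrow> 'b" where
  "ext_scale \<iota> c v = \<iota> c * v"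

text \<open>The subring obtained by adjoining \<open>\<omega>\<close> to the image of \<open>\<iota>\<close>.\<close>

definition adjoin :: "('a::field \<Rightarrow> 'b::field) \<Rightarrow> 'b \<Rightarrow> 'b set" where
  "adjoin \<iota> \<omega> = range (\<lambda>p. poly (map_poly \<iota> p) \<omega>)"

text \<open>
  \<open>module\<close> also names a locale of HOL-Algebra, hence the qualifier.  A caveat on \<open>vector_space.dim\<close>:
  it is 0 on infinite-dimensional spaces; on subspaces of \<open>adjoin \<iota> \<omega>\<close> with \<open>\<omega>\<close> algebraic it is the
  usual dimension.
\<close>

abbreviation ext_subspace :: "('a::field \<Rightarrow> 'b::field) \<Rightarrow> 'b set \<Rightarrow> bool" where
  "ext_subspace \<iota> \<equiv> Modules.module.subspace (ext_scale \<iota>)"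

abbreviation ext_dim :: "('a::field \<Rightarrow> 'b::field) \<Rightarrow> 'b set \<Rightarrow> nat" where
  "ext_dim \<iota> \<equiv> Vector_Spaces.vector_space.dim (ext_scale \<iota>)"

lemma vector_space_ext_scale:
  assumes "field_hom \<iota>"
  shows "Vector_Spaces.vector_space (ext_scale \<iota>)"
proof -
  interpret field_hom \<iota> by (fact assms)
  show ?thesis
    by unfold_locales (simp_all add: ext_scale_def hom_distribs algebra_simps)
qed

end

theory Submission
  imports Defs
begin

text \<open>
  A proper subspace \<open>V\<close> of \<open>E = F[\<omega>]\<close> lies in the kernel of a nonzero functional \<open>\<phi>\<close>, and since \<open>F\<close> is
  finite, every functional on \<open>E\<close> has the form \<open>v \<mapsto> \<phi> (u v)\<close> for some \<open>u \<in> E\<close>.  As \<open>\<omega>\<^sup>n = 1\<close>, the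
  point \<open>u\<close> is covered by a translate of the kernel of \<open>\<phi>\<close> iff the functional \<open>v \<mapsto> \<phi> (u v)\<close>
  vanishes at some power of \<open>\<omega>\<close>.  Hence one hyperplane has the covering property iff every
  functional vanishes at some power of \<open>\<omega>\<close>, and the functionals which vanish at one of
  \<open>1, \<omega>, \<dots>, \<omega>\<^bsup>d - 1\<^esup>\<close> satisfy this trivially.
\<close>

locale algebraic_element = field_hom \<iota>
  for \<iota> :: "'a::field \<Rightarrow> 'b::field" +
  fixes f :: "'a poly" and \<omega> :: 'b
  assumes irreducible_f: "irreducible f"
    and root_f: "poly (map_poly \<iota> f) \<omega> = 0"
begin

sublocale ext: Vector_Spaces.vector_space "ext_scale \<iota>"
  by (rule vector_space_ext_scale) (rule field_hom_axioms)

section \<open>Evaluation of polynomials at \<omega>\<close>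

definition ev :: "'a poly \<Rightarrow> 'b" where
  "ev p = poly (map_poly \<iota> p) \<omega>"

lemma ev_simps [simp]:
  "ev (p + q) = ev p + ev q" "ev (p - q) = ev p - ev q" "ev (p * q) = ev p * ev q"
  "ev 0 = 0" "ev 1 = 1" "ev (monom c i) = \<iota> c * \<omega> ^ i" "ev (sum h A) = (\<Sum>x\<in>A. ev (h x))"
proof -
  interpret map_hom: map_poly_comm_ring_hom \<iota> ..
  show "ev (p + q) = ev p + ev q" "ev (p - q) = ev p - ev q" "ev (p * q) = ev p * ev q"
    "ev 0 = 0" "ev 1 = 1" "ev (monom c i) = \<iota> c * \<omega> ^ i" "ev (sum h A) = (\<Sum>x\<in>A. ev (h x))"
    by (simp_all add: ev_def hom_distribs poly_monom poly_sum)
qed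

lemma ev_f [simp]: "ev f = 0"
  by (simp add: ev_def root_f)

lemma ev_const: "ev [:c:] = \<iota> c"
  using ev_simps(6)[of c 0] by (simp add: monom_0 del: ev_simps)

lemma adjoin_eq: "adjoin \<iota> \<omega> = range ev"
  by (simp add: adjoin_def ev_def[abs_def])

text \<open>A nonzero polynomial of least degree vanishing at \<open>\<omega>\<close> divides \<open>f\<close>.\<close>

lemma degree_le_if_ev_eq_0:
  assumes "p \<noteq> 0" "ev p = 0"
  shows "degree f \<le> degree p"
proof -
  define m where "m = (ARG_MIN degree p. p \<noteq> 0 \<and> ev p = 0)"
  have m: "m \<noteq> 0" "ev m = 0" and min: "\<And>r. r \<noteq> 0 \<Longrightarrow> ev r = 0 \<Longrightarrow> degree m \<le> degree r"
    using arg_min_nat_lemma[of "\<lambda>p. p \<noteq> 0 \<and> ev p = 0" p degree] assms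
    unfolding m_def by blast+
  have "ev (f mod m) = ev (f - m * (f div m))"
    by (simp add: minus_mult_div_eq_mod)
  also have "\<dots> = 0"
    using m by simp
  finally have "f mod m = 0"
    using min[of "f mod m"] degree_mod_less[OF m(1), of f] by fastforce
  then obtain r where r: "f = m * r"
    by (metis dvd_mult_div_cancel mod_eq_0_iff_dvd)
  have "\<not> is_unit m"
  proof
    assume "is_unit m"
    then obtain s where "1 = m * s" by (metis dvd_mult_div_cancel)
    then have "ev 1 = ev m * ev s" by (metis ev_simps(3))
    with m show False by simp
  qed
  with r have "is_unit r"
    using irreducible_f irreducibleD by blast
  with r m have "degree f = degree m"
    by (metis degree_mult_eq is_unit_iff_degree add.right_neutral not_is_unit_0)
  then show ?thesis
    using min[OF assms] by simp
qed

lemma degree_f_pos: "0 < degree f"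
proof (rule ccontr)
  assume "\<not> 0 < degree f"
  then have "is_unit f"
    using irreducible_f by (metis is_unit_iff_degree irreducible_def neq0_conv)
  then show False
    using irreducible_f by (simp add: irreducible_def)
qed

text \<open>The difference of two such polynomials with equal value would vanish at \<omega> in too
  small a degree. This is the linear independence of the first \<open>degree f\<close> powers of
  \<omega>.\<close>

lemma inj_on_ev: "inj_on ev {p. degree p < degree f}"
proof (rule inj_onI, rule ccontr)
  fix p r assume pr: "p \<in> {p. degree p < degree f}" "r \<in> {p. degree p < degree f}"
    "ev p = ev r" "p \<noteq> r"
  then have "degree f \<le> degree (p - r)"
    by (intro degree_le_if_ev_eq_0) auto
  moreover have "degree (p - r) < degree f"
    using pr by (simp add: degree_diff_less)
  ultimately show False by simp
qed

section \<open>Coordinates of elements of F[\<omega>]\<close>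

definition comb :: "(nat \<Rightarrow> 'a) \<Rightarrow> 'b" where
  "comb x = (\<Sum>j<degree f. \<iota> (x j) * \<omega> ^ j)"

lemma comb_eq_ev: "comb x = ev (\<Sum>j<degree f. monom (x j) j)"
  by (simp add: comb_def)

lemma comb_eq_comb_iff: "comb x = comb y \<longleftrightarrow> (\<forall>j<degree f. x j = y j)"
proof
  assume eq: "comb x = comb y"
  have deg: "degree (\<Sum>j<degree f. monom (z j) j) < degree f" for z :: "nat \<Rightarrow> 'a"
    using degree_f_pos by (intro degree_sum_less) (auto intro: le_less_trans[OF degree_monom_le])
  have "(\<Sum>j<degree f. monom (x j) j) = (\<Sum>j<degree f. monom (y j) j)"
    using inj_onD[OF inj_on_ev] eq deg by (simp add: comb_eq_ev del: ev_simps)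
  then have "coeff (\<Sum>j<degree f. monom (x j) j) k = coeff (\<Sum>j<degree f. monom (y j) j) k" for k
    by simp
  then show "\<forall>j<degree f. x j = y j"
    unfolding coeff_sum coeff_monom by (auto simp: if_split_eq1 dest: spec)
qed (simp add: comb_def)

text \<open>Reducing a polynomial modulo \<open>f\<close> leaves its value at \<omega> unchanged, so
  remainders give all elements.\<close>

lemma adjoin_eq_range_comb: "adjoin \<iota> \<omega> = range comb"
proof
  show "range comb \<subseteq> adjoin \<iota> \<omega>"
    by (auto simp: adjoin_eq comb_eq_ev simp del: ev_simps)
  show "adjoin \<iota> \<omega> \<subseteq> range comb"
  proof
    fix v assume "v \<in> adjoin \<iota> \<omega>"
    then obtain p where p: "v = ev p" by (auto simp: adjoin_eq)
    define r where "r = p mod f"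
    have "ev p = ev (f * (p div f) + r)"
      unfolding r_def by (simp only: mult_div_mod_eq)
    then have "v = ev r" using p by simp
    have "f \<noteq> 0" using degree_f_pos by auto
    then have "degree r < degree f"
      using degree_mod_less[of f p] degree_f_pos by (auto simp: r_def)
    then have "r = (\<Sum>j<degree f. monom (coeff r j) j)"
      by (intro poly_eqI) (auto simp: coeff_sum coeff_eq_0)
    with \<open>v = ev r\<close> show "v \<in> range comb"
      by (metis comb_eq_ev rangeI)
  qed
qed

lemma adjoin_mult: "u \<in> adjoin \<iota> \<omega> \<Longrightarrow> v \<in> adjoin \<iota> \<omega> \<Longrightarrow> u * v \<in> adjoin \<iota> \<omega>"
  unfolding adjoin_eq by (auto simp flip: ev_simps(3))

lemma power_in_adjoin: "\<omega> ^ i \<in> adjoin \<iota> \<omega>"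
  unfolding adjoin_eq using ev_simps(6)[of 1 i] by (metis hom_one mult_1 rangeI)

lemma subspace_adjoin: "ext.subspace (adjoin \<iota> \<omega>)"
proof (rule ext.subspaceI)
  show "0 \<in> adjoin \<iota> \<omega>"
    unfolding adjoin_eq by (metis ev_simps(4) rangeI)
  show "u + v \<in> adjoin \<iota> \<omega>" if "u \<in> adjoin \<iota> \<omega>" "v \<in> adjoin \<iota> \<omega>" for u v
    using that unfolding adjoin_eq by (auto simp flip: ev_simps(1))
  show "ext_scale \<iota> c v \<in> adjoin \<iota> \<omega>" if "v \<in> adjoin \<iota> \<omega>" for c v
    using that unfolding adjoin_eq ext_scale_def by (auto simp flip: ev_simps(3) ev_const)
qed

section \<open>The power basis and the dimension\<close>

definition powers :: "'b set" where
  "powers = (\<lambda>j. \<omega> ^ j) ` {..<degree f}"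

lemma inj_on_power: "inj_on (\<lambda>j. \<omega> ^ j) {..<degree f}"
proof (rule inj_onI)
  fix i j assume ij: "i \<in> {..<degree f}" "j \<in> {..<degree f}" "\<omega> ^ i = \<omega> ^ j"
  then have "monom 1 i = (monom 1 j :: 'a poly)"
    by (intro inj_onD[OF inj_on_ev]) (auto simp: degree_monom_eq)
  then show "i = j"
    by (metis degree_monom_eq one_neq_zero)
qed

lemma sum_powers: "(\<Sum>v\<in>powers. g v) = (\<Sum>j<degree f. g (\<omega> ^ j))"
  unfolding powers_def by (simp add: sum.reindex[OF inj_on_power])

lemma finite_powers [simp]: "finite powers"
  by (simp add: powers_def)

lemma independent_powers: "ext.independent powers"
proof (rule ext.independent_if_scalars_zero)
  fix g v assume g: "(\<Sum>v\<in>powers. ext_scale \<iota> (g v) v) = 0" and v: "v \<in> powers"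
  from g have "comb (\<lambda>j. g (\<omega> ^ j)) = comb (\<lambda>_. 0)"
    by (simp add: sum_powers comb_def ext_scale_def)
  then show "g v = 0"
    using v by (auto simp: comb_eq_comb_iff powers_def)
qed simp

lemma span_powers: "ext.span powers = adjoin \<iota> \<omega>"
proof
  show "ext.span powers \<subseteq> adjoin \<iota> \<omega>"
    by (rule ext.span_minimal) (auto simp: powers_def power_in_adjoin subspace_adjoin)
  show "adjoin \<iota> \<omega> \<subseteq> ext.span powers"
    unfolding adjoin_eq_range_comb comb_def ext_scale_def[symmetric]
    by (auto intro!: ext.span_sum intro: ext.span_scale ext.span_base simp: powers_def)
qed

lemma dim_adjoin: "ext.dim (adjoin \<iota> \<omega>) = degree f"
  using ext.dim_eq_card_independent[OF independent_powers] card_image[OF inj_on_power]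
  by (simp add: powers_def flip: span_powers)

section \<open>Linear functionals on F[\<omega>]\<close>

text \<open>Linearity is required on the adjoined ring only, since coordinate maps of a basis of it
  need not be linear on all of \<open>'b\<close>.\<close>

definition functional :: "('b \<Rightarrow> 'a) \<Rightarrow> bool" where
  "functional \<phi> \<longleftrightarrow>
    (\<forall>u\<in>adjoin \<iota> \<omega>. \<forall>v\<in>adjoin \<iota> \<omega>. \<phi> (u + v) = \<phi> u + \<phi> v) \<and>
    (\<forall>v\<in>adjoin \<iota> \<omega>. \<forall>c. \<phi> (\<iota> c * v) = c * \<phi> v)"

text \<open>Coordinates with respect to a basis supply the functionals for both directions of the
  theorem.\<close>

lemma functional_representation:
  assumes "ext.independent B" "ext.span B = adjoin \<iota> \<omega>"
  shows "functional (\<lambda>v. ext.representation B v b)"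
  using ext.representation_add[OF assms(1)] ext.representation_scale[OF assms(1)]
  by (simp add: functional_def assms(2) ext_scale_def)

lemma functional_sum:
  assumes "functional \<phi>" "\<And>j. j \<in> A \<Longrightarrow> v j \<in> adjoin \<iota> \<omega>"
  shows "\<phi> (\<Sum>j\<in>A. \<iota> (c j) * v j) = (\<Sum>j\<in>A. c j * \<phi> (v j))"
  using assms(2)
proof (induction A rule: infinite_finite_induct)
  case (insert j A)
  have "(\<Sum>j\<in>A. \<iota> (c j) * v j) \<in> adjoin \<iota> \<omega>"
    using insert.prems ext.subspace_scale[OF subspace_adjoin]
    by (intro ext.subspace_sum[OF subspace_adjoin]) (auto simp: ext_scale_def)
  moreover have "\<iota> (c j) * v j \<in> adjoin \<iota> \<omega>"
    using insert.prems ext.subspace_scale[OF subspace_adjoin] by (simp add: ext_scale_def)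
  ultimately show ?case
    using insert assms(1) by (simp add: functional_def)
qed (use assms(1) ext.subspace_0[OF subspace_adjoin] in \<open>force simp: functional_def\<close>)+

text \<open>The functional \<open>v \<mapsto> \<phi> (u * v)\<close> is determined by its values at
  the first \<open>degree f\<close> powers of \<omega>.\<close>

lemma functional_mult_comb:
  assumes "functional \<phi>" "u \<in> adjoin \<iota> \<omega>"
  shows "\<phi> (u * comb x) = (\<Sum>j<degree f. x j * \<phi> (u * \<omega> ^ j))"
proof -
  have "u * comb x = (\<Sum>j<degree f. \<iota> (x j) * (u * \<omega> ^ j))"
    by (simp add: comb_def sum_distrib_left mult_ac)
  also have "\<phi> \<dots> = (\<Sum>j<degree f. x j * \<phi> (u * \<omega> ^ j))"
    using assms(2) by (intro functional_sum[OF assms(1)] adjoin_mult power_in_adjoin)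
  finally show ?thesis .
qed

text \<open>Extend a basis \<open>C\<close> of \<open>V\<close> to a basis \<open>B\<close> of the
  whole space and take the coordinate at some \<open>b\<close> in \<open>B\<close> outside
  \<open>C\<close>. Expansions of elements of \<open>V\<close> involve only \<open>C\<close>, while
  \<open>b\<close> itself has coordinate 1.\<close>

lemma functional_vanishing_on_proper_subspace:
  assumes V: "ext.subspace V" "V \<subseteq> adjoin \<iota> \<omega>" "V \<noteq> adjoin \<iota> \<omega>"
  obtains \<phi> b where "functional \<phi>" "\<forall>v\<in>V. \<phi> v = 0" "b \<in> adjoin \<iota> \<omega>" "\<phi> b \<noteq> 0"
proof -
  obtain C where C: "C \<subseteq> V" "ext.independent C" "V \<subseteq> ext.span C"
    by (rule ext.maximal_independent_subset)
  obtain B where B: "C \<subseteq> B" "B \<subseteq> adjoin \<iota> \<omega>" "ext.independent B" "adjoin \<iota> \<omega> \<subseteq> ext.span B"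
    using ext.maximal_independent_subset_extend[OF order_trans[OF C(1) V(2)] C(2)] .
  have span: "ext.span B = adjoin \<iota> \<omega>"
    using ext.span_minimal[OF B(2) subspace_adjoin] B(4) by (rule antisym)
  have "ext.span C = V"
    using ext.span_minimal[OF C(1) V(1)] C(3) by (rule antisym)
  with span V(3) have "B \<noteq> C"
    by metis
  with B(1) obtain b where b: "b \<in> B" "b \<notin> C"
    by blast
  show ?thesis
  proof
    show "functional (\<lambda>v. ext.representation B v b)"
      using B(3) span by (rule functional_representation)
    show "b \<in> adjoin \<iota> \<omega>" "ext.representation B b b \<noteq> 0"
      using b B(2) ext.representation_basis[OF B(3) b(1)] by auto
    show "\<forall>v\<in>V. ext.representation B v b = 0"
    proof
      fix v assume "v \<in> V"
      then have "ext.representation B v = ext.representation C v"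
        using ext.representation_extend[OF B(3) _ B(1)] C(3) by blast
      then show "ext.representation B v b = 0"
        using b ext.representation_ne_zero by metis
    qed
  qed
qed

text \<open>
  If \<open>\<phi> (u \<omega>\<^sup>j) = \<phi> (u' \<omega>\<^sup>j)\<close> for all \<open>j < d\<close>, then \<open>\<phi>\<close> vanishes on \<open>(u - u') E\<close>, which is all
  of \<open>E\<close> for \<open>u \<noteq> u'\<close>; so the map sending \<open>u\<close> to these \<open>d\<close> values is injective, hence surjective because both sides have
  \<open>q\<^sup>d\<close> elements.
\<close>

lemma functional_prescribed_values:
  assumes fin: "finite (UNIV :: 'a set)"
    and \<phi>: "functional \<phi>" and b: "b \<in> adjoin \<iota> \<omega>" "\<phi> b \<noteq> 0"
  obtains u where "u \<in> adjoin \<iota> \<omega>" "\<And>j. j < degree f \<Longrightarrow> \<phi> (u * \<omega> ^ j) = x j"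
proof -
  let ?E = "adjoin \<iota> \<omega>"
  let ?X = "{..<degree f} \<rightarrow>\<^sub>E (UNIV :: 'a set)"
  define T where "T u = restrict (\<lambda>j. \<phi> (u * \<omega> ^ j)) {..<degree f}" for u
  have finX: "finite ?X"
    using fin by (simp add: finite_PiE)
  \<comment> \<open>Extensional functions stand for coefficient tuples; their values beyond the
    index range are fixed, which makes \<open>comb\<close> injective on them.\<close>
  have bij: "bij_betw comb ?X ?E"
    unfolding bij_betw_def
  proof
    show "inj_on comb ?X"
      by (rule inj_onI) (erule PiE_ext, assumption, simp add: comb_eq_comb_iff)
    have "comb y \<in> comb ` ?X" for y
      by (rule image_eqI[of _ _ "restrict y {..<degree f}"]) (auto simp: comb_eq_comb_iff)
    then show "comb ` ?X = ?E"
      unfolding adjoin_eq_range_comb by blast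
  qed
  then have finE: "finite ?E" and card: "card ?E = card ?X"
    using finX bij_betw_finite bij_betw_same_card by (blast, metis)
  have "inj_on T ?E"
  proof (rule inj_onI, rule ccontr)
    fix u v assume uv: "u \<in> ?E" "v \<in> ?E" "T u = T v" "u \<noteq> v"
    have w: "u - v \<in> ?E"
      using uv ext.subspace_diff[OF subspace_adjoin] by blast
    have "inj_on ((*) (u - v)) ?E"
      using uv by (auto intro!: inj_onI)
    then have "(*) (u - v) ` ?E = ?E"
      using finE w adjoin_mult by (intro endo_inj_surj) auto
    then obtain y where y: "b = (u - v) * comb y"
      using b adjoin_eq_range_comb by (metis (no_types, lifting) imageE)
    have eq: "\<phi> (u * \<omega> ^ j) = \<phi> (v * \<omega> ^ j)" if "j < degree f" for j
      using fun_cong[OF uv(3), of j] that by (simp add: T_def)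
    have "\<phi> (u * comb y) = \<phi> (b + v * comb y)"
      by (simp add: y algebra_simps)
    also have "\<dots> = \<phi> b + \<phi> (v * comb y)"
      using \<phi> b uv by (simp add: functional_def adjoin_mult adjoin_eq_range_comb[symmetric]
          rangeI[of comb, folded adjoin_eq_range_comb])
    finally have "\<phi> b = 0"
      using uv \<phi> eq by (simp add: functional_mult_comb)
    with b show False by simp
  qed
  moreover have "T ` ?E \<subseteq> ?X"
    unfolding T_def by (intro image_subsetI restrict_PiE_iff[THEN iffD2]) auto
  ultimately have "T ` ?E = ?X"
    using card card_image card_subset_eq finX by metis
  then have "restrict x {..<degree f} \<in> T ` ?E"
    by auto
  then obtain u where u: "u \<in> ?E" "T u = restrict x {..<degree f}"
    by auto
  show ?thesis
  proof
    show "u \<in> ?E" by fact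
    show "\<phi> (u * \<omega> ^ j) = x j" if "j < degree f" for j
      using fun_cong[OF u(2), of j] that by (simp add: T_def)
  qed
qed

section \<open>A hyperplane as the kernel of a coordinate\<close>

definition hyperplane :: "'b set" where
  "hyperplane = ext.span (powers - {1})"

lemma one_in_powers: "1 \<in> powers"
  unfolding powers_def using degree_f_pos by (intro image_eqI[of _ _ 0]) auto

lemma hyperplane_subset_adjoin: "hyperplane \<subseteq> adjoin \<iota> \<omega>"
  unfolding hyperplane_def span_powers[symmetric] by (rule ext.span_mono) auto

lemma dim_hyperplane: "ext.dim hyperplane = degree f - 1"
proof -
  have "ext.independent (powers - {1})"
    using independent_powers ext.independent_mono by blast
  moreover have "card powers = degree f"
    unfolding powers_def by (simp add: card_image[OF inj_on_power])
  ultimately show ?thesis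
    unfolding hyperplane_def
    by (simp add: ext.dim_eq_card_independent one_in_powers)
qed

text \<open>The term at 1 drops out of the expansion of \<open>v\<close> in the power basis.
  Membership can thus be tested with the coordinate functional at 1.\<close>

lemma in_hyperplaneI:
  assumes v: "v \<in> adjoin \<iota> \<omega>" and 0: "ext.representation powers v 1 = 0"
  shows "v \<in> hyperplane"
proof -
  have "v = (\<Sum>b\<in>powers. ext_scale \<iota> (ext.representation powers v b) b)"
    using ext.sum_representation_eq[OF independent_powers _ finite_powers subset_refl] v
    by (simp add: span_powers)
  also have "\<dots> = (\<Sum>b\<in>powers - {1}. ext_scale \<iota> (ext.representation powers v b) b)"
    using 0 by (intro sum.mono_neutral_right) (auto simp: ext_scale_def)
  also have "\<dots> \<in> hyperplane"
    unfolding hyperplane_def by (intro ext.span_sum ext.span_scale ext.span_base)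
  finally show ?thesis .
qed

end

section \<open>Covering translates versus vanishing of functionals\<close>

theorem theorem3p2:
  fixes \<iota> :: "'a::{field, finite} \<Rightarrow> 'b::field"
    and q n d :: nat
    and f :: "'a poly"
    and \<omega> :: 'b
    and a :: "nat \<Rightarrow> nat \<Rightarrow> 'a"
  assumes q: "card (UNIV :: 'a set) = q"
    and n: "0 < n"
    and f: "irreducible f" "degree f = d" "f dvd monom 1 n - 1"
    and \<iota>: "field_hom \<iota>"
    and root: "poly (map_poly \<iota> f) \<omega> = 0"
    and a: "\<And>i. i \<in> {1..n} \<Longrightarrow> \<omega> ^ i = (\<Sum>j=1..d. \<iota> (a i j) * \<omega> ^ (j - 1))"
  shows "(\<exists>V. V \<subseteq> adjoin \<iota> \<omega> \<and> ext_subspace \<iota> V \<and> ext_dim \<iota> V = d - 1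
              \<and> (\<Union>i\<in>{0..n - 1}. (\<lambda>v. \<omega> ^ i * v) ` V) = adjoin \<iota> \<omega>)
     \<longleftrightarrow> (\<forall>x :: nat \<Rightarrow> 'a. (\<forall>j\<in>{1..d}. x j \<noteq> 0)
            \<longrightarrow> (\<exists>i\<in>{d..n}. (\<Sum>j=1..d. x j * a i j) = 0))"
    (is "?L \<longleftrightarrow> ?R")
proof -
  interpret algebraic_element \<iota> f \<omega>
    using f(1) \<iota> root by (simp add: algebraic_element_def algebraic_element_axioms_def)
  let ?E = "adjoin \<iota> \<omega>"
  have d: "0 < d"
    using degree_f_pos f(2) by simp
  obtain g where "monom 1 n - 1 = f * g"
    using f(3) by (metis dvd_mult_div_cancel)
  then have "ev (monom 1 n - 1) = ev f * ev g"
    by (metis ev_simps(3))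
  then have \<omega>n: "\<omega> ^ n = 1"
    by simp
  \<comment> \<open>The coefficients \<open>a i j\<close> are numbered from 1, those of
    \<open>comb\<close> from 0.\<close>
  have shift: "(\<Sum>j=1..d. h j (j - 1)) = (\<Sum>j<d. h (Suc j) j)"
    for h :: "nat \<Rightarrow> nat \<Rightarrow> 'c::comm_monoid_add"
    by (rule sum.reindex_bij_witness[of _ Suc "\<lambda>j. j - 1"]) auto
  have \<omega>i: "\<omega> ^ i = comb (\<lambda>j. a i (Suc j))" if "i \<in> {1..n}" for i
    using a[OF that] shift[of "\<lambda>j k. \<iota> (a i j) * \<omega> ^ k"] f(2) by (simp add: comb_def)
  \<comment> \<open>The sum in \<open>?R\<close> is the value at \<open>\<omega> ^ i\<close> of the
    functional whose values at the basis powers are the \<open>x j\<close>.\<close>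
  have \<phi>\<omega>i: "\<phi> (u * \<omega> ^ i) = (\<Sum>j=1..d. \<phi> (u * \<omega> ^ (j - 1)) * a i j)"
    if "functional \<phi>" "u \<in> ?E" "i \<in> {1..n}" for \<phi> u i
    using functional_mult_comb[OF that(1,2), of "\<lambda>j. a i (Suc j)"] \<omega>i[OF that(3)] f(2)
      shift[of "\<lambda>j k. \<phi> (u * \<omega> ^ k) * a i j"] by (simp add: mult.commute)
  show ?thesis
  proof
    assume ?L
    then obtain V where V: "V \<subseteq> ?E" "ext.subspace V" "ext.dim V = d - 1"
      and cover: "(\<Union>i\<in>{0..n - 1}. (\<lambda>v. \<omega> ^ i * v) ` V) = ?E"
      by blast
    have "V \<noteq> ?E"
      using V(3) dim_adjoin f(2) d by auto
    then obtain \<phi> b where \<phi>: "functional \<phi>" "\<forall>v\<in>V. \<phi> v = 0" and b: "b \<in> ?E" "\<phi> b \<noteq> 0"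
      using functional_vanishing_on_proper_subspace V by metis
    show ?R
    proof (intro allI impI)
      fix x :: "nat \<Rightarrow> 'a" assume x: "\<forall>j\<in>{1..d}. x j \<noteq> 0"
      \<comment> \<open>The given tuple is realised as a twist of \<phi> by some \<open>u\<close>;
        the translate of \<open>V\<close> containing \<open>u\<close> then yields the required
        exponent.\<close>
      obtain u where u: "u \<in> ?E" "\<And>j. j < d \<Longrightarrow> \<phi> (u * \<omega> ^ j) = x (Suc j)"
        using functional_prescribed_values[OF finite \<phi>(1) b, of "\<lambda>j. x (Suc j)"] f(2) by metis
      from u(1) cover obtain i v where i: "i \<le> n - 1" and v: "v \<in> V" "u = \<omega> ^ i * v"
        by force
      \<comment> \<open>Multiplication by \<open>\<omega> ^ k\<close> undoes the translation by
        \<open>\<omega> ^ i\<close>; the bound \<open>i \<le> n - 1\<close> gives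
        \<open>k \<ge> 1\<close>.\<close>
      define k where "k = n - i"
      have k: "k \<in> {1..n}" "i + k = n"
        using i n by (auto simp: k_def)
      have "u * \<omega> ^ k = \<omega> ^ (i + k) * v"
        by (simp add: v power_add mult_ac)
      then have "u * \<omega> ^ k = v"
        by (simp only: k \<omega>n mult_1)
      then have 0: "\<phi> (u * \<omega> ^ k) = 0"
        using \<phi>(2) v(1) by metis
      \<comment> \<open>For \<open>k < d\<close> the value \<open>\<phi> (u * \<omega> ^ k)\<close>
        would be the nonzero entry \<open>x (Suc k)\<close>.\<close>
      have "d \<le> k"
      proof (rule ccontr)
        assume "\<not> d \<le> k"
        with 0 u(2)[of k] x show False by auto
      qed
      moreover have "(\<Sum>j=1..d. x j * a k j) = (\<Sum>j=1..d. \<phi> (u * \<omega> ^ (j - 1)) * a k j)"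
        using u(2) by (intro sum.cong) auto
      then have "(\<Sum>j=1..d. x j * a k j) = 0"
        using \<phi>\<omega>i[OF \<phi>(1) u(1) k(1)] 0 by metis
      ultimately show "\<exists>i\<in>{d..n}. (\<Sum>j=1..d. x j * a i j) = 0"
        using k by auto
    qed
  next
    assume R: ?R
    let ?\<phi> = "\<lambda>v. ext.representation powers v 1"
    have \<phi>: "functional ?\<phi>"
      using functional_representation independent_powers span_powers by blast
    have cover: "u \<in> (\<Union>i\<in>{0..n - 1}. (\<lambda>v. \<omega> ^ i * v) ` hyperplane)" if u: "u \<in> ?E" for u
    proof -
      \<comment> \<open>Either one of the first \<open>d\<close> values is already zero, or they
        form a tuple to which \<open>?R\<close> applies.\<close>
      obtain k where "?\<phi> (u * \<omega> ^ k) = 0"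
      proof (cases "\<forall>j\<in>{1..d}. ?\<phi> (u * \<omega> ^ (j - 1)) \<noteq> 0")
        case True
        with R obtain i where i: "i \<in> {d..n}" "(\<Sum>j=1..d. ?\<phi> (u * \<omega> ^ (j - 1)) * a i j) = 0"
          by meson
        then have "?\<phi> (u * \<omega> ^ i) = 0"
          using \<phi>\<omega>i[OF \<phi> u, of i] d by simp
        then show ?thesis by (rule that)
      qed (use that in blast)
      then have k: "u * \<omega> ^ k \<in> hyperplane"
        using in_hyperplaneI adjoin_mult u power_in_adjoin by blast
      \<comment> \<open>This is the residue of \<open>-k\<close> modulo \<open>n\<close>, written
        without subtracting \<open>k\<close> because no bound on \<open>k\<close> was
        recorded.\<close>
      define i where "i = (n - 1) * k mod n"
      have "\<omega> ^ ((n - 1) * k) = (\<omega> ^ n) ^ ((n - 1) * k div n) * \<omega> ^ i"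
        unfolding i_def by (metis mult_div_mod_eq power_add power_mult)
      then have "\<omega> ^ i * \<omega> ^ k = \<omega> ^ ((n - 1) * k) * \<omega> ^ k"
        by (simp only: \<omega>n power_one mult_1)
      also have "\<dots> = (\<omega> ^ n) ^ k"
        using n by (cases n) (simp_all add: power_mult algebra_simps flip: power_add)
      finally have "u = \<omega> ^ i * (u * \<omega> ^ k)"
        by (simp add: \<omega>n mult.left_commute)
      moreover have "i \<in> {0..n - 1}"
        using n mod_less_divisor[OF n, of "(n - 1) * k"] by (auto simp: i_def)
      ultimately show ?thesis
        using k by blast
    qed
    show ?L
    proof (intro exI conjI)
      show "hyperplane \<subseteq> ?E"
        by (rule hyperplane_subset_adjoin)
      show "ext.subspace hyperplane"
        by (simp add: hyperplane_def)
      show "ext.dim hyperplane = d - 1"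
        by (simp add: dim_hyperplane f(2))
      show "(\<Union>i\<in>{0..n - 1}. (\<lambda>v. \<omega> ^ i * v) ` hyperplane) = ?E"
        using cover hyperplane_subset_adjoin adjoin_mult power_in_adjoin by blast
    qed
  qed
qed

end
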